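(* Let $s_0\in(0,1)$ and $u\in H^{s_0}_\gamma(\mathbb{R}^N)$. Then $$\lim_{s\to 0^+}s[u]^2_{H^s_\gamma(\mathbb{R}^N)}=2\left(\|u\|^2_{L^2_\gamma(\mathbb{R}^N)}-\left|\int_{\mathbb{R}^N}u\,d\gamma\right|^2\right).$$
   Context: $N\in\mathbb{N}$, $N\ge 1$. $\gamma$ denotes the standard Gaussian probability measure on $\mathbb{R}^N$, $d\gamma(x)=(2\pi)^{-N/2}e^{-|x|^2/2}\,dx$, and $L^2_\gamma(\mathbb{R}^N)$ is the space of (real-valued) functions that are square-integrable with respect to $\gamma$, with its usual norm. For $t>0$ and $x,y\in\mathbb{R}^N$ the Mehler kernel is $$M_t(x,y):=\frac{1}{(1-e^{-2t})^{N/2}}\exp\left(-\frac{e^{-2t}|x|^2-2e^{-t}x\cdot y+e^{-2t}|y|^2}{2(1-e^{-2t})}\right),$$ and for $\sigma>0$ $$K_\sigma(x,y):=\int_0^\infty\frac{M_t(x,y)}{t^{\frac{\sigma}{2}+1}}\,dt.$$ For $s\in(0,1)$, the fractional Gaussian Sobolev space is $$H^s_\gamma(\mathbb{R}^N):=\left\{u\in L^2_\gamma(\mathbb{R}^N):\ [u]_{H^s_\gamma(\mathbb{R}^N)}<\infty\right\},$$ where $$[u]_{H^s_\gamma(\mathbb{R}^N)}:=\left(\int_{\mathbb{R}^N}d\gamma(x)\int_{\mathbb{R}^N}|u(x)-u(y)|^2K_{2s}(x,y)\,d\gamma(y)\right)^{1/2},$$ that is, the kernel $K_\sigma$ is used with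 $\sigma=2s$. *)

theory Defs
  imports "HOL-Analysis.Analysis"
begin

definition gauss_measure :: "(real ^ 'n) measure" where
  "gauss_measure =
     density lborel (\<lambda>x. ennreal ((2 * pi) powr (- real CARD('n) / 2) * exp (- (norm x)\<^sup>2 / 2)))"

text \<open>Elements of \<open>L\<^sup>2\<close> are represented by Borel measurable functions; every
  almost-everywhere class of Lebesgue measurable functions has such a representative.\<close>

definition gauss_L2 :: "(real ^ 'n \<Rightarrow> real) set" where
  "gauss_L2 = {u. u \<in> borel_measurable gauss_measure \<and>
                  integrable gauss_measure (\<lambda>x. (u x)\<^sup>2)}"

definition gauss_L2_norm :: "(real ^ 'n \<Rightarrow> real) \<Rightarrow> real" where
  "gauss_L2_norm u = sqrt (LINT x|gauss_measure. (u x)\<^sup>2)"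

definition mehler_kernel :: "real \<Rightarrow> real ^ 'n \<Rightarrow> real ^ 'n \<Rightarrow> real" where
  "mehler_kernel t x y =
     1 / (1 - exp (- 2 * t)) powr (real CARD('n) / 2) *
     exp (- ((exp (- 2 * t) * (norm x)\<^sup>2 - 2 * exp (- t) * (x \<bullet> y) + exp (- 2 * t) * (norm y)\<^sup>2)
             / (2 * (1 - exp (- 2 * t)))))"

text \<open>The integrand is positive, and the integral is infinite on the diagonal \<open>x = y\<close>
  when \<open>\<sigma> > 0\<close>; hence the kernel takes values in \<^typ>\<open>ennreal\<close>.\<close>

definition frac_kernel :: "real \<Rightarrow> real ^ 'n \<Rightarrow> real ^ 'n \<Rightarrow> ennreal" where
  "frac_kernel \<sigma> x y =
     (\<integral>\<^sup>+ t \<in> {0<..}. ennreal (mehler_kernel t x y / t powr (\<sigma> / 2 + 1)) \<partial>lborel)"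

text \<open>In the double integral the diagonal contributes \<open>0 * \<infinity> = 0\<close> (and is a null set anyway).\<close>

definition frac_energy :: "real \<Rightarrow> (real ^ 'n \<Rightarrow> real) \<Rightarrow> ennreal" where
  "frac_energy s u =
     (\<integral>\<^sup>+ x. (\<integral>\<^sup>+ y. ennreal (\<bar>u x - u y\<bar>\<^sup>2) * frac_kernel (2 * s) x y \<partial>gauss_measure)
        \<partial>gauss_measure)"

text \<open>The square root of the energy in \<open>[0, \<infinity>]\<close>.\<close>

definition frac_seminorm :: "real \<Rightarrow> (real ^ 'n \<Rightarrow> real) \<Rightarrow> ereal" where
  "frac_seminorm s u =
     (if frac_energy s u = \<infinity> then \<infinity> else ereal (sqrt (enn2real (frac_energy s u))))"

definition gauss_frac_sobolev :: "real \<Rightarrow> (real ^ 'n \<Rightarrow> real) set" where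
  "gauss_frac_sobolev s = {u \<in> gauss_L2. frac_seminorm s u < \<infinity>}"

end

theory Submission
  imports Defs "HOL-Probability.Distributions"
begin

text \<open>
  Write \<open>\<gamma>\<close> for the Gaussian measure and
  \<open>e(t) = \<integral>\<integral> (u(x) - u(y))\<^sup>2 M\<^sub>t(x,y) d\<gamma>(x) d\<gamma>(y)\<close> for the energy of \<open>u\<close> at time \<open>t\<close>.
  By Tonelli the squared seminorm is the weighted integral \<open>\<integral>\<^sub>0\<^sup>\<infinity> e(t) t\<^sup>-\<^sup>s\<^sup>-\<^sup>1 dt\<close>
  (\<open>frac_energy_eq_nn_integral_mehler_energy\<close>). As \<open>s\<close> decreases to \<open>0\<close>, the weights
  \<open>s t\<^sup>-\<^sup>s\<^sup>-\<^sup>1\<close> put mass tending to \<open>1\<close> on every half-line \<open>[T, \<infinity>)\<close> with \<open>T > 0\<close>, while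
  finiteness at the single exponent \<open>s\<^sub>0\<close> makes the contribution of \<open>(0, T)\<close> vanish.
  Hence the limit is that of \<open>e\<close> at infinity (\<open>abelian_power_weight\<close>).

  The kernel \<open>M\<^sub>t\<close> tends to \<open>1\<close> pointwise, but for a merely square-integrable \<open>u\<close> there need not be a
  fixed integrable function that dominates \<open>(u(x) - u(y))\<^sup>2 M\<^sub>t(x,y)\<close>. However, \<open>M\<^sub>t\<close> is symmetric and
  Markov: \<open>M\<^sub>t(x,y) d\<gamma>(y)\<close> is the Gaussian law with mean \<open>e\<^sup>-\<^sup>t x\<close> and variance
  \<open>1 - e\<^sup>-\<^sup>2\<^sup>t\<close> in each coordinate (\<open>mehler_kernel_times_gauss\<close>). Therefore the majorant
  \<open>h(x,y) = 2 u(x)\<^sup>2 + 2 u(y)\<^sup>2\<close> of \<open>(u(x) - u(y))\<^sup>2\<close> has the same integral against \<open>M\<^sub>t\<close> for all \<open>t > 0\<close>,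
  and Scheffe's lemma turns this conservation of mass into \<open>h M\<^sub>t \<rightarrow> h\<close> in \<open>L\<^sup>1\<close>
  (\<open>weighted_integral_tendsto\<close>). So \<open>e(t)\<close> tends to
  \<open>\<integral>\<integral> (u(x) - u(y))\<^sup>2 d\<gamma>(x) d\<gamma>(y)\<close>, which is twice the variance of \<open>u\<close>.
\<close>

section \<open>Gaussian densities\<close>

lemma prod_normal_density:
  fixes m y :: "'a::euclidean_space"
  assumes "0 < \<sigma>"
  shows "(\<Prod>b\<in>Basis. normal_density (m \<bullet> b) \<sigma> (y \<bullet> b)) =
    (2 * pi * \<sigma>\<^sup>2) powr (- real DIM('a) / 2) * exp (- (norm (y - m))\<^sup>2 / (2 * \<sigma>\<^sup>2))"
proof -
  have c: "0 < 2 * pi * \<sigma>\<^sup>2" using assms by simp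
  have norm: "(norm (y - m))\<^sup>2 = (\<Sum>b\<in>Basis. (y \<bullet> b - m \<bullet> b)\<^sup>2)"
    by (subst power2_norm_eq_inner, subst euclidean_inner) (simp add: inner_diff_left power2_eq_square)
  have "1 / sqrt (2 * pi * \<sigma>\<^sup>2) = (2 * pi * \<sigma>\<^sup>2) powr (- 1 / 2)"
    using c by (simp add: powr_minus_divide powr_half_sqrt)
  moreover have "((2 * pi * \<sigma>\<^sup>2) powr (- 1 / 2)) ^ DIM('a) = (2 * pi * \<sigma>\<^sup>2) powr (real DIM('a) * (- 1 / 2))"
    using c by (intro powr_power) (rule less_imp_neq[symmetric])
  moreover have "real DIM('a) * (- 1 / 2) = - real DIM('a) / 2" by simp
  ultimately have "(\<Prod>b\<in>(Basis :: 'a set). 1 / sqrt (2 * pi * \<sigma>\<^sup>2)) = (2 * pi * \<sigma>\<^sup>2) powr (- real DIM('a) / 2)"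
    by (simp only: prod_constant)
  moreover have "(\<Prod>b\<in>Basis. exp (- (y \<bullet> b - m \<bullet> b)\<^sup>2 / (2 * \<sigma>\<^sup>2))) = exp (- (norm (y - m))\<^sup>2 / (2 * \<sigma>\<^sup>2))"
    by (simp add: norm exp_sum[symmetric] sum_divide_distrib sum_negf)
  ultimately show ?thesis
    unfolding normal_density_def prod.distrib by simp
qed

lemma nn_integral_gaussian_density:
  fixes m :: "'a::euclidean_space"
  assumes "0 < \<sigma>"
  shows "(\<integral>\<^sup>+y. ennreal ((2 * pi * \<sigma>\<^sup>2) powr (- real DIM('a) / 2) *
            exp (- (norm (y - m))\<^sup>2 / (2 * \<sigma>\<^sup>2))) \<partial>lborel) = 1"
proof -
  have one: "(\<integral>\<^sup>+t. ennreal (normal_density \<mu> \<sigma> t) \<partial>lborel) = 1" for \<mu>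
    using assms by (subst nn_integral_eq_integral) auto
  have "(\<integral>\<^sup>+y. (\<Prod>b\<in>Basis. ennreal (normal_density (m \<bullet> b) \<sigma> (y \<bullet> b))) \<partial>(lborel :: 'a measure)) = 1"
    by (subst nn_integral_lborel_prod) (simp_all add: one)
  then show ?thesis
    by (simp add: prod_ennreal prod_normal_density[OF assms])
qed

section \<open>The Gaussian measure and the Mehler kernel\<close>

lemma sets_gauss_measure [simp, measurable_cong]: "sets gauss_measure = sets borel"
  by (simp add: gauss_measure_def)

lemma space_gauss_measure [simp]: "space gauss_measure = UNIV"
  by (simp add: gauss_measure_def)

lemma prob_space_gauss_measure: "prob_space (gauss_measure :: (real^'n) measure)"
proof
  show "emeasure gauss_measure (space (gauss_measure :: (real^'n) measure)) = 1"
    using nn_integral_gaussian_density[of 1 "0 :: real^'n"]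
    by (simp add: gauss_measure_def emeasure_density)
qed

lemma mehler_kernel_nonneg: "0 \<le> mehler_kernel t x y"
  by (simp add: mehler_kernel_def)

lemma mehler_kernel_commute: "mehler_kernel t x y = mehler_kernel t y x"
  by (simp add: mehler_kernel_def inner_commute algebra_simps)

lemma measurable_mehler_kernel [measurable]:
  assumes "f \<in> borel_measurable M" "g \<in> borel_measurable M" "h \<in> borel_measurable M"
  shows "(\<lambda>w. mehler_kernel (f w) (g w :: real^'n) (h w)) \<in> borel_measurable M"
  using assms unfolding mehler_kernel_def by measurable

text \<open>Completing the square: \<open>e\<^sup>-\<^sup>2\<^sup>t |x|\<^sup>2 - 2 e\<^sup>-\<^sup>t x \<bullet> y + e\<^sup>-\<^sup>2\<^sup>t |y|\<^sup>2 + (1 - e\<^sup>-\<^sup>2\<^sup>t) |y|\<^sup>2 = |y - e\<^sup>-\<^sup>t x|\<^sup>2\<close>.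
  The Mehler kernel is thus the transition density of the Ornstein-Uhlenbeck process relative to its
  invariant measure.\<close>

lemma mehler_kernel_times_gauss:
  fixes x y :: "real^'n"
  assumes "0 < t"
  defines "v \<equiv> 1 - exp (- 2 * t)"
  shows "(2 * pi) powr (- real CARD('n) / 2) * exp (- (norm y)\<^sup>2 / 2) * mehler_kernel t x y =
    (2 * pi * v) powr (- real CARD('n) / 2) * exp (- (norm (y - exp (- t) *\<^sub>R x))\<^sup>2 / (2 * v))"
proof -
  have v: "0 < v" using assms by (simp add: v_def)
  have e: "exp (- 2 * t) = exp (- t) * exp (- t)" by (simp add: exp_add[symmetric])
  have w: "exp (- 2 * t) = 1 - v" by (simp add: v_def)
  have n: "(norm (y - exp (- t) *\<^sub>R x))\<^sup>2 =
      (norm y)\<^sup>2 - 2 * exp (- t) * (x \<bullet> y) + exp (- 2 * t) * (norm x)\<^sup>2"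
    unfolding e power2_norm_eq_inner
    by (simp add: inner_diff_left inner_diff_right inner_commute algebra_simps)
  have "exp (- (norm y)\<^sup>2 / 2) * exp (- ((exp (- 2 * t) * (norm x)\<^sup>2 - 2 * exp (- t) * (x \<bullet> y)
        + exp (- 2 * t) * (norm y)\<^sup>2) / (2 * v))) = exp (- (norm (y - exp (- t) *\<^sub>R x))\<^sup>2 / (2 * v))"
    unfolding exp_add[symmetric] n w using v by (simp add: field_simps)
  moreover have "(2 * pi) powr (- real CARD('n) / 2) * (1 / v powr (real CARD('n) / 2)) =
      (2 * pi * v) powr (- real CARD('n) / 2)"
    using v by (simp add: powr_mult powr_minus_divide)
  moreover have rearrange: "a * b * (c * d) = (a * c) * (b * d)" for a b c d :: real
    by (simp only: mult_ac)
  ultimately show ?thesis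
    unfolding mehler_kernel_def v_def[symmetric]
    by (subst rearrange) (simp only:)
qed

lemma nn_integral_mehler_kernel:
  fixes x :: "real^'n"
  assumes "0 < t"
  shows "(\<integral>\<^sup>+y. ennreal (mehler_kernel t x y) \<partial>gauss_measure) = 1"
proof -
  have v: "0 < sqrt (1 - exp (- 2 * t))" and v2: "(sqrt (1 - exp (- 2 * t)))\<^sup>2 = 1 - exp (- 2 * t)"
    using assms by auto
  have "(\<integral>\<^sup>+y. ennreal (mehler_kernel t x y) \<partial>gauss_measure) =
    (\<integral>\<^sup>+y. ennreal ((2 * pi) powr (- real CARD('n) / 2) * exp (- (norm y)\<^sup>2 / 2) * mehler_kernel t x y) \<partial>lborel)"
    unfolding gauss_measure_def by (subst nn_integral_density) (auto simp: ennreal_mult mehler_kernel_nonneg)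
  also have "\<dots> = 1"
    unfolding mehler_kernel_times_gauss[OF assms]
    using nn_integral_gaussian_density[OF v, of "exp (- t) *\<^sub>R x"] unfolding v2 by simp
  finally show ?thesis .
qed

lemma mehler_kernel_tendsto_1:
  fixes x y :: "real^'n"
  shows "((\<lambda>t. mehler_kernel t x y) \<longlongrightarrow> 1) at_top"
proof -
  have e1: "((\<lambda>t::real. exp (- t)) \<longlongrightarrow> 0) at_top"
    by (rule filterlim_compose[OF exp_at_bot filterlim_uminus_at_bot_at_top])
  have e2: "((\<lambda>t::real. exp (- 2 * t)) \<longlongrightarrow> 0) at_top"
    using tendsto_mult[OF e1 e1] by (simp add: exp_add[symmetric])
  have "((\<lambda>t. mehler_kernel t x y) \<longlongrightarrow> 1 / (1 - 0) powr (real CARD('n) / 2) *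
      exp (- ((0 * (norm x)\<^sup>2 - 2 * 0 * (x \<bullet> y) + 0 * (norm y)\<^sup>2) / (2 * (1 - 0))))) at_top"
    unfolding mehler_kernel_def by (intro tendsto_intros e1 e2) auto
  then show ?thesis by simp
qed

section \<open>Convergence under conserved mass\<close>

text \<open>Conservation of the mass of \<open>h k\<^sub>n\<close> replaces the dominating function of dominated convergence:
  Scheffe's lemma gives \<open>h k\<^sub>n \<rightarrow> h\<close> in \<open>L\<^sup>1\<close>, and \<open>|f k\<^sub>n - f| \<le> |h k\<^sub>n - h|\<close> because the two sides
  are \<open>|k\<^sub>n - 1|\<close> times \<open>|f|\<close> and \<open>h\<close>.\<close>

lemma weighted_integral_tendsto:
  fixes f h :: "'a \<Rightarrow> real" and k :: "nat \<Rightarrow> 'a \<Rightarrow> real"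
  assumes h: "integrable M h"
    and f [measurable]: "f \<in> borel_measurable M" and fh: "\<And>x. \<bar>f x\<bar> \<le> h x"
    and k [measurable]: "\<And>n. k n \<in> borel_measurable M" and k0: "\<And>n x. 0 \<le> k n x"
    and lim: "\<And>x. (\<lambda>n. k n x) \<longlonglongrightarrow> 1"
    and mass: "\<And>n. (\<integral>\<^sup>+x. ennreal (h x * k n x) \<partial>M) = (\<integral>\<^sup>+x. ennreal (h x) \<partial>M)"
  shows "(\<lambda>n. \<integral>x. f x * k n x \<partial>M) \<longlonglongrightarrow> (\<integral>x. f x \<partial>M)"
proof -
  have [measurable]: "h \<in> borel_measurable M" using h by simp
  have h0: "0 \<le> h x" for x using fh[of x] by simp
  have fin: "(\<integral>\<^sup>+x. ennreal (h x) \<partial>M) < \<infinity>"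
    using h h0 by (simp add: nn_integral_eq_integral)
  have hk: "integrable M (\<lambda>x. h x * k n x)" for n
    using fin mass[of n] h0 k0 by (intro integrableI_nonneg) auto
  have fk: "integrable M (\<lambda>x. f x * k n x)" for n
    using fh k0 by (intro Bochner_Integration.integrable_bound[OF hk[of n]])
      (auto simp: abs_mult h0 intro!: mult_right_mono)
  have fi: "integrable M f"
    using fh h0 by (intro Bochner_Integration.integrable_bound[OF h]) auto
  have "(\<lambda>n. \<integral>\<^sup>+x. norm (h x * k n x - h x) \<partial>M) \<longlonglongrightarrow> 0"
  proof (rule Scheffe_lemma2[OF _ h])
    show "AE x in M. (\<lambda>n. h x * k n x) \<longlonglongrightarrow> h x"
      using tendsto_mult_left[OF lim] by auto
  qed (use mass h0 k0 in auto)
  then have *: "(\<lambda>n. \<integral>\<^sup>+x. norm (f x * k n x - f x) \<partial>M) \<longlonglongrightarrow> 0"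
  proof (rule tendsto_sandwich[OF _ _ tendsto_const, rotated 2])
    have "\<bar>f x * k n x - f x\<bar> \<le> \<bar>h x * k n x - h x\<bar>" for n x
    proof -
      have "\<bar>f x\<bar> * \<bar>k n x - 1\<bar> \<le> \<bar>h x\<bar> * \<bar>k n x - 1\<bar>"
        using fh[of x] by (intro mult_right_mono) auto
      then show ?thesis by (simp add: abs_mult[symmetric] algebra_simps)
    qed
    then show "\<forall>\<^sub>F n in sequentially. (\<integral>\<^sup>+x. norm (f x * k n x - f x) \<partial>M) \<le> (\<integral>\<^sup>+x. norm (h x * k n x - h x) \<partial>M)"
      by (intro always_eventually allI nn_integral_mono) auto
  qed simp
  show ?thesis
    by (rule tendsto_L1_int[OF fk fi *])
qed

text \<open>The term \<open>w(x)\<close> is integrated in \<open>y\<close> first, where the kernel has mass one; by symmetry of the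
  kernel the term \<open>w(y)\<close> contributes the same amount.\<close>

lemma nn_integral_pair_symmetric_kernel:
  fixes w :: "'a \<Rightarrow> real" and k :: "'a \<times> 'a \<Rightarrow> real"
  assumes "sigma_finite_measure M"
    and w: "integrable M w" "\<And>x. 0 \<le> w x"
    and k [measurable]: "k \<in> borel_measurable (M \<Otimes>\<^sub>M M)" and k0: "\<And>p. 0 \<le> k p"
    and sym: "\<And>x y. k (x, y) = k (y, x)"
    and mass: "\<And>x. x \<in> space M \<Longrightarrow> (\<integral>\<^sup>+y. ennreal (k (x, y)) \<partial>M) = 1"
  shows "(\<integral>\<^sup>+p. ennreal ((w (fst p) + w (snd p)) * k p) \<partial>(M \<Otimes>\<^sub>M M)) = ennreal (2 * (\<integral>x. w x \<partial>M))"
proof -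
  interpret sigma_finite_measure M by fact
  interpret P: pair_sigma_finite M M by unfold_locales
  have [measurable]: "w \<in> borel_measurable M" using w by simp
  have one: "(\<integral>\<^sup>+x. \<integral>\<^sup>+y. ennreal (w x) * ennreal (k (x, y)) \<partial>M \<partial>M) = ennreal (\<integral>x. w x \<partial>M)"
  proof -
    have "(\<integral>\<^sup>+x. \<integral>\<^sup>+y. ennreal (w x) * ennreal (k (x, y)) \<partial>M \<partial>M) = (\<integral>\<^sup>+x. ennreal (w x) \<partial>M)"
      by (intro nn_integral_cong) (simp add: nn_integral_cmult mass)
    also have "\<dots> = ennreal (\<integral>x. w x \<partial>M)" using w by (intro nn_integral_eq_integral) auto
    finally show ?thesis .
  qed
  have one': "(\<integral>\<^sup>+y. \<integral>\<^sup>+x. ennreal (w y) * ennreal (k (x, y)) \<partial>M \<partial>M) = ennreal (\<integral>x. w x \<partial>M)"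
    by (subst sym) (rule one)
  have fst: "(\<integral>\<^sup>+p. ennreal (w (fst p)) * ennreal (k p) \<partial>(M \<Otimes>\<^sub>M M)) = ennreal (\<integral>x. w x \<partial>M)"
    using nn_integral_fst[of "\<lambda>p. ennreal (w (fst p)) * ennreal (k p)" M] by (simp add: one)
  have snd: "(\<integral>\<^sup>+p. ennreal (w (snd p)) * ennreal (k p) \<partial>(M \<Otimes>\<^sub>M M)) = ennreal (\<integral>x. w x \<partial>M)"
    using P.nn_integral_snd[of "\<lambda>p. ennreal (w (snd p)) * ennreal (k p)"] one' by simp
  have "(\<integral>\<^sup>+p. ennreal ((w (fst p) + w (snd p)) * k p) \<partial>(M \<Otimes>\<^sub>M M)) =
     (\<integral>\<^sup>+p. ennreal (w (fst p)) * ennreal (k p) + ennreal (w (snd p)) * ennreal (k p) \<partial>(M \<Otimes>\<^sub>M M))"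
    using w k0 by (intro nn_integral_cong) (simp add: distrib_right ennreal_mult ennreal_plus)
  also have "\<dots> = ennreal (2 * (\<integral>x. w x \<partial>M))"
    using w by (subst nn_integral_add) (simp_all add: fst snd ennreal_plus[symmetric] integral_nonneg_AE del: ennreal_plus)
  finally show ?thesis .
qed

lemma power2_diff_le: "(a - b)\<^sup>2 \<le> 2 * a\<^sup>2 + 2 * (b :: real)\<^sup>2"
  using zero_le_power2[of "a + b"] by (simp add: power2_sum power2_diff)

lemma nn_integral_squares_pair:
  fixes u :: "'a \<Rightarrow> real"
  assumes "prob_space M" and u [measurable]: "u \<in> borel_measurable M" and u2: "integrable M (\<lambda>x. (u x)\<^sup>2)"
  shows "(\<integral>\<^sup>+p. ennreal (2 * (u (fst p))\<^sup>2 + 2 * (u (snd p))\<^sup>2) \<partial>(M \<Otimes>\<^sub>M M)) = ennreal (4 * (\<integral>x. (u x)\<^sup>2 \<partial>M))"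
proof -
  interpret prob_space M by fact
  have "(\<integral>\<^sup>+p. ennreal ((2 * (u (fst p))\<^sup>2 + 2 * (u (snd p))\<^sup>2) * 1) \<partial>(M \<Otimes>\<^sub>M M)) = ennreal (2 * (\<integral>x. 2 * (u x)\<^sup>2 \<partial>M))"
    by (rule nn_integral_pair_symmetric_kernel[where w = "\<lambda>x. 2 * (u x)\<^sup>2"])
       (use u2 sigma_finite_measure_axioms in \<open>auto simp: emeasure_space_1\<close>)
  then show ?thesis by simp
qed

text \<open>The last claim is the identity \<open>E (X - Y)\<^sup>2 = 2 Var X\<close> for independent \<open>X\<close>, \<open>Y\<close> with the law of \<open>u\<close>.\<close>

lemma integrable_pair_difference_squared:
  fixes u :: "'a \<Rightarrow> real"
  assumes "prob_space M" and u [measurable]: "u \<in> borel_measurable M" and u2: "integrable M (\<lambda>x. (u x)\<^sup>2)"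
  shows "integrable (M \<Otimes>\<^sub>M M) (\<lambda>p. 2 * (u (fst p))\<^sup>2 + 2 * (u (snd p))\<^sup>2)" (is ?sum)
    and "integrable (M \<Otimes>\<^sub>M M) (\<lambda>p. (u (fst p) - u (snd p))\<^sup>2)" (is ?diff)
    and "(\<integral>p. (u (fst p) - u (snd p))\<^sup>2 \<partial>(M \<Otimes>\<^sub>M M)) = 2 * ((\<integral>x. (u x)\<^sup>2 \<partial>M) - (\<integral>x. u x \<partial>M)\<^sup>2)"
proof -
  interpret prob_space M by fact
  interpret pair_sigma_finite M M by unfold_locales
  have sum: ?sum
    by (intro integrableI_nonneg) (simp_all add: nn_integral_squares_pair[OF prob_space_axioms u u2] del: ennreal_plus)
  then show ?sum .
  show diff: ?diff
  proof (rule Bochner_Integration.integrable_bound[OF sum])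
    show "AE p in M \<Otimes>\<^sub>M M. norm ((u (fst p) - u (snd p))\<^sup>2) \<le> norm (2 * (u (fst p))\<^sup>2 + 2 * (u (snd p))\<^sup>2)"
      by (simp add: power2_diff_le)
  qed measurable
  have ui: "integrable M u"
    by (rule square_integrable_imp_integrable[OF u u2])
  have "(\<integral>p. (u (fst p) - u (snd p))\<^sup>2 \<partial>(M \<Otimes>\<^sub>M M)) = (\<integral>x. \<integral>y. (u x - u y)\<^sup>2 \<partial>M \<partial>M)"
    using integral_fst'[OF diff] by simp
  also have "\<dots> = (\<integral>x. (u x)\<^sup>2 - 2 * u x * (\<integral>y. u y \<partial>M) + (\<integral>y. (u y)\<^sup>2 \<partial>M) \<partial>M)"
    using ui u2 by (intro Bochner_Integration.integral_cong) (auto simp: power2_diff prob_space)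
  also have "\<dots> = 2 * ((\<integral>x. (u x)\<^sup>2 \<partial>M) - (\<integral>x. u x \<partial>M)\<^sup>2)"
    using ui u2 by (simp add: prob_space power2_eq_square)
  finally show "(\<integral>p. (u (fst p) - u (snd p))\<^sup>2 \<partial>(M \<Otimes>\<^sub>M M)) = 2 * ((\<integral>x. (u x)\<^sup>2 \<partial>M) - (\<integral>x. u x \<partial>M)\<^sup>2)" .
qed

section \<open>An Abelian theorem for power weights\<close>

lemma nn_integral_power_tail:
  fixes a T :: real
  assumes "0 < a" "0 < T"
  shows "(\<integral>\<^sup>+t\<in>{T..}. ennreal (1 / t powr (a + 1)) \<partial>lborel) = ennreal (T powr (- a) / a)"
proof -
  have "(\<integral>\<^sup>+t\<in>{T..}. ennreal (1 / t powr (a + 1)) \<partial>lborel) = ennreal (0 - (- (T powr (- a)) / a))"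
  proof (rule nn_integral_FTC_atLeast)
    show "((\<lambda>t. - (t powr (- a)) / a) has_real_derivative 1 / t powr (a + 1)) (at t)" if "T \<le> t" for t
      using that assms by (auto intro!: derivative_eq_intros simp: powr_minus_divide powr_diff powr_add field_simps)
    show "((\<lambda>t. - (t powr (- a)) / a) \<longlongrightarrow> 0) at_top"
      using tendsto_divide[OF tendsto_minus[OF tendsto_neg_powr[OF _ filterlim_ident]] tendsto_const, of "- a" a] assms
      by simp
  qed auto
  then show ?thesis by simp
qed

text \<open>The upper bound splits at \<open>T\<close>. Since \<open>T \<ge> 1\<close>, every \<open>t < T\<close> satisfies
  \<open>t\<^sup>-\<^sup>s\<^sup>-\<^sup>1 = t\<^bsup>s\<^sub>0-s\<^esup> t\<^bsup>-s\<^sub>0-1\<^esup> \<le> T\<^bsup>s\<^sub>0\<^esup> t\<^bsup>-s\<^sub>0-1\<^esup>\<close>, so the part near the origin is controlled, uniformly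
  in \<open>s\<close>, by the integral at the fixed exponent \<open>s\<^sub>0\<close>.\<close>

lemma nn_integral_power_weight_bounds:
  fixes e :: "real \<Rightarrow> real"
  assumes e [measurable]: "e \<in> borel_measurable borel" and e0: "\<And>t. 0 \<le> e t"
    and T: "1 \<le> T" and s: "0 < s" "s \<le> s\<^sub>0"
    and A0: "0 \<le> A" and A: "\<And>t. T \<le> t \<Longrightarrow> A \<le> e t" and B: "\<And>t. T \<le> t \<Longrightarrow> e t \<le> B"
  shows "ennreal (A * T powr (- s) / s) \<le> (\<integral>\<^sup>+t\<in>{0<..}. ennreal (e t / t powr (s + 1)) \<partial>lborel)"
    and "(\<integral>\<^sup>+t\<in>{0<..}. ennreal (e t / t powr (s + 1)) \<partial>lborel) \<le>
      ennreal (T powr s\<^sub>0) * (\<integral>\<^sup>+t\<in>{0<..}. ennreal (e t / t powr (s\<^sub>0 + 1)) \<partial>lborel)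
        + ennreal (B * T powr (- s) / s)"
proof -
  have B0: "0 \<le> B" using B[of T] e0[of T] by simp
  have tail: "(\<integral>\<^sup>+t. ennreal C * (ennreal (1 / t powr (s + 1)) * indicator {T..} t) \<partial>lborel) = ennreal (C * T powr (- s) / s)"
    if "0 \<le> C" for C
    using nn_integral_power_tail[of s T] s T that
    by (subst nn_integral_cmult) (auto simp: ennreal_mult[symmetric])
  show "ennreal (A * T powr (- s) / s) \<le> (\<integral>\<^sup>+t\<in>{0<..}. ennreal (e t / t powr (s + 1)) \<partial>lborel)"
    unfolding tail[OF A0, symmetric]
    using T A A0 by (intro nn_integral_mono)
      (auto simp: indicator_def ennreal_mult[symmetric] intro!: ennreal_leI divide_right_mono)
  have "ennreal (e t / t powr (s + 1)) * indicator {0<..} t \<le>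
      ennreal (T powr s\<^sub>0) * (ennreal (e t / t powr (s\<^sub>0 + 1)) * indicator {0<..} t)
        + ennreal B * (ennreal (1 / t powr (s + 1)) * indicator {T..} t)" for t
  proof (cases "0 < t \<and> t < T")
    case True
    have "t powr (s\<^sub>0 + 1) = t powr (s\<^sub>0 - s) * t powr (s + 1)"
      using True by (simp add: powr_add[symmetric])
    moreover have "t powr (s\<^sub>0 - s) \<le> T powr (s\<^sub>0 - s)"
      using True s by (intro powr_mono2) auto
    moreover have "T powr (s\<^sub>0 - s) \<le> T powr s\<^sub>0"
      using T s by (intro powr_mono) auto
    ultimately have "t powr (s\<^sub>0 + 1) \<le> T powr s\<^sub>0 * t powr (s + 1)"
      by (simp add: mult_right_mono)
    then have "1 / t powr (s + 1) \<le> T powr s\<^sub>0 / t powr (s\<^sub>0 + 1)"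
      using True by (simp add: field_simps)
    then have "e t / t powr (s + 1) \<le> T powr s\<^sub>0 * (e t / t powr (s\<^sub>0 + 1))"
      using e0[of t] mult_left_mono[of "1 / t powr (s + 1)" "T powr s\<^sub>0 / t powr (s\<^sub>0 + 1)" "e t"]
      by (simp add: mult_ac)
    then show ?thesis
      using True e0[of t] by (auto simp: ennreal_mult[symmetric] intro!: ennreal_leI)
  next
    case False
    then show ?thesis
      using B[of t] B0 T
      by (auto simp: indicator_def ennreal_mult[symmetric] intro!: ennreal_leI divide_right_mono add_increasing)
  qed
  then have "(\<integral>\<^sup>+t\<in>{0<..}. ennreal (e t / t powr (s + 1)) \<partial>lborel) \<le>
    (\<integral>\<^sup>+t. ennreal (T powr s\<^sub>0) * (ennreal (e t / t powr (s\<^sub>0 + 1)) * indicator {0<..} t)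
        + ennreal B * (ennreal (1 / t powr (s + 1)) * indicator {T..} t) \<partial>lborel)"
    by (intro nn_integral_mono)
  also have "\<dots> = ennreal (T powr s\<^sub>0) * (\<integral>\<^sup>+t\<in>{0<..}. ennreal (e t / t powr (s\<^sub>0 + 1)) \<partial>lborel)
        + ennreal (B * T powr (- s) / s)"
    by (simp add: nn_integral_add nn_integral_cmult[symmetric] tail[OF B0])
  finally show "(\<integral>\<^sup>+t\<in>{0<..}. ennreal (e t / t powr (s + 1)) \<partial>lborel) \<le>
      ennreal (T powr s\<^sub>0) * (\<integral>\<^sup>+t\<in>{0<..}. ennreal (e t / t powr (s\<^sub>0 + 1)) \<partial>lborel)
        + ennreal (B * T powr (- s) / s)" .
qed

text \<open>Multiplied by \<open>s\<close>, the bounds for \<open>A = L - \<epsilon>\<close> (cut off at \<open>0\<close>) and \<open>B = L + \<epsilon>\<close> become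
  \<open>A T\<^sup>-\<^sup>s\<close> and \<open>O(s) + B T\<^sup>-\<^sup>s\<close>, where \<open>T\<close> depends on \<open>\<epsilon>\<close> only and \<open>T\<^sup>-\<^sup>s \<rightarrow> 1\<close>.\<close>

lemma abelian_power_weight:
  fixes e :: "real \<Rightarrow> real"
  defines "I \<equiv> \<lambda>s. \<integral>\<^sup>+t\<in>{0<..}. ennreal (e t / t powr (s + 1)) \<partial>lborel"
  assumes e [measurable]: "e \<in> borel_measurable borel" and e0: "\<And>t. 0 \<le> e t"
    and lim: "(e \<longlongrightarrow> L) at_top"
    and s\<^sub>0: "0 < s\<^sub>0" and fin: "I s\<^sub>0 < \<infinity>"
  shows "\<forall>\<^sub>F s in at_right 0. I s < \<infinity>"
    and "((\<lambda>s. s * enn2real (I s)) \<longlongrightarrow> L) (at_right 0)"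
proof -
  have L0: "0 \<le> L"
    by (rule tendsto_lowerbound[OF lim]) (auto simp: e0)
  have range: "\<forall>\<^sub>F s in at_right 0. s \<in> {0<..<s\<^sub>0}"
    using eventually_at_right_real[OF s\<^sub>0] .
  define F where "F = enn2real (I s\<^sub>0)"
  have F: "I s\<^sub>0 = ennreal F" "0 \<le> F" using fin by (auto simp: F_def)
  have bounds: "\<exists>T\<ge>1. \<forall>s\<in>{0<..<s\<^sub>0}. I s < \<infinity> \<and> max 0 (L - \<epsilon>) * T powr (- s) \<le> s * enn2real (I s) \<and>
      s * enn2real (I s) \<le> s * (T powr s\<^sub>0 * F) + (L + \<epsilon>) * T powr (- s)" if "0 < \<epsilon>" for \<epsilon>
  proof -
    have "\<forall>\<^sub>F t in at_top. dist (e t) L < \<epsilon>" using tendstoD[OF lim that] .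
    then obtain T where T: "1 \<le> T" "\<And>t. T \<le> t \<Longrightarrow> dist (e t) L < \<epsilon>"
      unfolding eventually_at_top_linorder by (metis max.bounded_iff max.cobounded1)
    have lo: "max 0 (L - \<epsilon>) \<le> e t" and up: "e t \<le> L + \<epsilon>" if "T \<le> t" for t
      using T(2)[OF that] e0[of t] by (auto simp: dist_real_def)
    show ?thesis
    proof (intro exI[of _ T] conjI ballI T)
      fix s assume s: "s \<in> {0<..<s\<^sub>0}"
      have l: "ennreal (max 0 (L - \<epsilon>) * T powr (- s) / s) \<le> I s"
        unfolding I_def
        by (rule nn_integral_power_weight_bounds(1)[where s\<^sub>0 = s\<^sub>0 and B = "L + \<epsilon>"]) (use e0 T s lo up in auto)
      have "I s \<le> ennreal (T powr s\<^sub>0) * I s\<^sub>0 + ennreal ((L + \<epsilon>) * T powr (- s) / s)"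
        unfolding I_def
        by (rule nn_integral_power_weight_bounds(2)[where A = 0]) (use e0 T s lo up in auto)
      then have u: "I s \<le> ennreal (T powr s\<^sub>0 * F + (L + \<epsilon>) * T powr (- s) / s)"
        using F L0 that s by (simp add: ennreal_mult[symmetric] ennreal_plus[symmetric] del: ennreal_plus)
      show f: "I s < \<infinity>"
        using le_less_trans[OF u] by simp
      obtain i where i: "I s = ennreal i" "0 \<le> i" using f by (cases "I s") auto
      show "max 0 (L - \<epsilon>) * T powr (- s) \<le> s * enn2real (I s)"
        using l s i by (simp add: field_simps)
      have "i \<le> T powr s\<^sub>0 * F + (L + \<epsilon>) * T powr (- s) / s"
        using u i F L0 that s by (simp add: ennreal_le_iff del: ennreal_plus)
      then have "s * i \<le> s * (T powr s\<^sub>0 * F + (L + \<epsilon>) * T powr (- s) / s)"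
        using s by (intro mult_left_mono) auto
      also have "\<dots> = s * (T powr s\<^sub>0 * F) + (L + \<epsilon>) * T powr (- s)"
        using s by (simp add: field_simps)
      finally show "s * enn2real (I s) \<le> s * (T powr s\<^sub>0 * F) + (L + \<epsilon>) * T powr (- s)"
        using i by simp
    qed
  qed
  show "\<forall>\<^sub>F s in at_right 0. I s < \<infinity>"
    using range bounds[of 1] by (auto elim!: eventually_mono)
  have Tlim: "((\<lambda>s. T powr (- s)) \<longlongrightarrow> 1) (at_right 0)" if "1 \<le> T" for T :: real
    using that by (auto intro!: tendsto_eq_intros)
  show "((\<lambda>s. s * enn2real (I s)) \<longlongrightarrow> L) (at_right 0)"
  proof (rule order_tendstoI)
    fix a assume a: "a < L"
    obtain T where T: "1 \<le> T" and
      b: "\<And>s. s \<in> {0<..<s\<^sub>0} \<Longrightarrow> max 0 (L - (L - a) / 2) * T powr (- s) \<le> s * enn2real (I s)"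
      using bounds[of "(L - a) / 2"] a by auto
    have "((\<lambda>s. max 0 (L - (L - a) / 2) * T powr (- s)) \<longlongrightarrow> max 0 (L - (L - a) / 2)) (at_right 0)"
      using tendsto_mult_left[OF Tlim[OF T]] by simp
    then have "\<forall>\<^sub>F s in at_right 0. a < max 0 (L - (L - a) / 2) * T powr (- s)"
      by (rule order_tendstoD) (use a in \<open>auto simp: field_simps less_max_iff_disj\<close>)
    with range show "\<forall>\<^sub>F s in at_right 0. a < s * enn2real (I s)"
      by eventually_elim (use b in fastforce)
  next
    fix a assume a: "L < a"
    obtain T where T: "1 \<le> T" and
      b: "\<And>s. s \<in> {0<..<s\<^sub>0} \<Longrightarrow> s * enn2real (I s) \<le> s * (T powr s\<^sub>0 * F) + (L + (a - L) / 2) * T powr (- s)"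
      using bounds[of "(a - L) / 2"] a by auto
    have "((\<lambda>s. s * (T powr s\<^sub>0 * F) + (L + (a - L) / 2) * T powr (- s)) \<longlongrightarrow>
        0 * (T powr s\<^sub>0 * F) + (L + (a - L) / 2) * 1) (at_right 0)"
      by (intro tendsto_intros Tlim T)
    then have "\<forall>\<^sub>F s in at_right 0. s * (T powr s\<^sub>0 * F) + (L + (a - L) / 2) * T powr (- s) < a"
      by (rule order_tendstoD) (use a in \<open>auto simp: field_simps\<close>)
    with range show "\<forall>\<^sub>F s in at_right 0. s * enn2real (I s) < a"
      by eventually_elim (use b in fastforce)
  qed
qed

section \<open>The energy at a fixed time\<close>

definition mehler_energy :: "(real^'n \<Rightarrow> real) \<Rightarrow> real \<Rightarrow> real" where
  "mehler_energy u t =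
    (\<integral>p. (u (fst p) - u (snd p))\<^sup>2 * mehler_kernel t (fst p) (snd p) \<partial>(gauss_measure \<Otimes>\<^sub>M gauss_measure))"

lemma nn_integral_squares_mehler:
  fixes u :: "real^'n \<Rightarrow> real"
  assumes u: "u \<in> gauss_L2" and "0 < t"
  shows "(\<integral>\<^sup>+p. ennreal ((2 * (u (fst p))\<^sup>2 + 2 * (u (snd p))\<^sup>2) * mehler_kernel t (fst p) (snd p))
      \<partial>(gauss_measure \<Otimes>\<^sub>M gauss_measure)) = ennreal (4 * (\<integral>x. (u x)\<^sup>2 \<partial>gauss_measure))"
proof -
  interpret prob_space "gauss_measure :: (real^'n) measure" by (rule prob_space_gauss_measure)
  have "(\<integral>\<^sup>+p. ennreal ((2 * (u (fst p))\<^sup>2 + 2 * (u (snd p))\<^sup>2) * mehler_kernel t (fst p) (snd p))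
      \<partial>(gauss_measure \<Otimes>\<^sub>M gauss_measure)) = ennreal (2 * (\<integral>x. 2 * (u x)\<^sup>2 \<partial>gauss_measure))"
  proof (rule nn_integral_pair_symmetric_kernel[where k = "\<lambda>p. mehler_kernel t (fst p) (snd p)" and w = "\<lambda>x. 2 * (u x)\<^sup>2"])
    show "sigma_finite_measure (gauss_measure :: (real^'n) measure)" by unfold_locales
    show "mehler_kernel t (fst (x, y)) (snd (x, y)) = mehler_kernel t (fst (y, x)) (snd (y, x))" for x y :: "real^'n"
      by (simp add: mehler_kernel_commute)
    show "integrable gauss_measure (\<lambda>x. 2 * (u x)\<^sup>2)"
      using u by (simp add: gauss_L2_def)
  qed (simp_all add: mehler_kernel_nonneg nn_integral_mehler_kernel[OF assms(2)])
  then show ?thesis by simp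
qed

lemma integrable_mehler_energy:
  fixes u :: "real^'n \<Rightarrow> real"
  assumes u: "u \<in> gauss_L2" and t: "0 < t"
  shows "integrable (gauss_measure \<Otimes>\<^sub>M gauss_measure)
    (\<lambda>p. (u (fst p) - u (snd p))\<^sup>2 * mehler_kernel t (fst p) (snd p))"
proof -
  have [measurable]: "u \<in> borel_measurable borel"
    using u by (simp add: gauss_L2_def cong: measurable_cong_sets)
  have "integrable (gauss_measure \<Otimes>\<^sub>M gauss_measure)
      (\<lambda>p. (2 * (u (fst p))\<^sup>2 + 2 * (u (snd p))\<^sup>2) * mehler_kernel t (fst p) (snd p))"
    by (rule integrableI_nonneg) (simp_all add: nn_integral_squares_mehler[OF assms] mehler_kernel_nonneg)
  then show ?thesis
  proof (rule Bochner_Integration.integrable_bound)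
    show "AE p in gauss_measure \<Otimes>\<^sub>M gauss_measure.
        norm ((u (fst p) - u (snd p))\<^sup>2 * mehler_kernel t (fst p) (snd p)) \<le>
        norm ((2 * (u (fst p))\<^sup>2 + 2 * (u (snd p))\<^sup>2) * mehler_kernel t (fst p) (snd p))"
      by (intro always_eventually allI) (simp add: abs_mult mehler_kernel_nonneg power2_diff_le mult_right_mono)
  qed measurable
qed

text \<open>Since the kernel is Markov only for positive times, the sequence of times is shifted to start
  where it has become positive.\<close>

lemma mehler_energy_tendsto:
  fixes u :: "real^'n \<Rightarrow> real"
  assumes u: "u \<in> gauss_L2"
  shows "(mehler_energy u \<longlongrightarrow> 2 * ((\<integral>x. (u x)\<^sup>2 \<partial>gauss_measure) - (\<integral>x. u x \<partial>gauss_measure)\<^sup>2)) at_top"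
proof (rule tendsto_at_topI_sequentially)
  fix X :: "nat \<Rightarrow> real" assume X: "filterlim X at_top sequentially"
  let ?P = "gauss_measure \<Otimes>\<^sub>M gauss_measure :: ((real^'n) \<times> (real^'n)) measure"
  have um [measurable]: "u \<in> borel_measurable borel"
    using u by (simp add: gauss_L2_def cong: measurable_cong_sets)
  have u2: "integrable gauss_measure (\<lambda>x. (u x)\<^sup>2)" and ug: "u \<in> borel_measurable gauss_measure" 
    using u by (simp_all add: gauss_L2_def)
  note pair = integrable_pair_difference_squared[OF prob_space_gauss_measure ug u2]
  obtain N where N: "\<And>n. N \<le> n \<Longrightarrow> 0 < X n"
    using X unfolding filterlim_at_top_dense eventually_sequentially by meson
  have mass: "(\<integral>\<^sup>+p. ennreal ((2 * (u (fst p))\<^sup>2 + 2 * (u (snd p))\<^sup>2) *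
      mehler_kernel (X (n + N)) (fst p) (snd p)) \<partial>?P) =
      (\<integral>\<^sup>+p. ennreal (2 * (u (fst p))\<^sup>2 + 2 * (u (snd p))\<^sup>2) \<partial>?P)" for n
    by (simp add: nn_integral_squares_mehler[OF u N] nn_integral_squares_pair[OF prob_space_gauss_measure ug u2] del: ennreal_plus)
  have "(\<lambda>n. mehler_energy u (X (n + N))) \<longlonglongrightarrow> (\<integral>p. (u (fst p) - u (snd p))\<^sup>2 \<partial>?P)"
    unfolding mehler_energy_def
  proof (rule weighted_integral_tendsto[OF pair(1) _ _ _ _ _ mass])
    show "\<bar>(u (fst p) - u (snd p))\<^sup>2\<bar> \<le> 2 * (u (fst p))\<^sup>2 + 2 * (u (snd p))\<^sup>2" for p
      by (simp add: power2_diff_le)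
    show "(\<lambda>n. mehler_kernel (X (n + N)) (fst p) (snd p)) \<longlonglongrightarrow> 1" for p :: "(real^'n) \<times> (real^'n)"
      using filterlim_compose[OF mehler_kernel_tendsto_1 X] by (rule LIMSEQ_ignore_initial_segment)
  qed (simp_all add: mehler_kernel_nonneg)
  then show "(\<lambda>n. mehler_energy u (X n)) \<longlonglongrightarrow> 2 * ((\<integral>x. (u x)\<^sup>2 \<partial>gauss_measure) - (\<integral>x. u x \<partial>gauss_measure)\<^sup>2)"
    unfolding pair(3) by (rule LIMSEQ_offset)
qed

lemma measurable_mehler_energy:
  fixes u :: "real^'n \<Rightarrow> real"
  assumes u: "u \<in> gauss_L2"
  shows "mehler_energy u \<in> borel_measurable borel"
proof -
  interpret prob_space "gauss_measure :: (real^'n) measure" by (rule prob_space_gauss_measure)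
  interpret pair_sigma_finite "gauss_measure :: (real^'n) measure" "gauss_measure :: (real^'n) measure" ..
  have [measurable]: "u \<in> borel_measurable borel"
    using u by (simp add: gauss_L2_def cong: measurable_cong_sets)
  show ?thesis unfolding mehler_energy_def by measurable
qed

section \<open>The fractional energy as a weighted time integral\<close>

lemma frac_energy_eq_nn_integral_mehler_energy:
  fixes u :: "real^'n \<Rightarrow> real"
  assumes u: "u \<in> gauss_L2"
  shows "frac_energy s u = (\<integral>\<^sup>+t\<in>{0<..}. ennreal (mehler_energy u t / t powr (s + 1)) \<partial>lborel)"
proof -
  let ?G = "gauss_measure :: (real^'n) measure"
  interpret prob_space ?G by (rule prob_space_gauss_measure)
  interpret PG: pair_sigma_finite ?G ?G ..
  interpret PL: pair_sigma_finite "?G \<Otimes>\<^sub>M ?G" "lborel :: real measure" ..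
  have [measurable]: "u \<in> borel_measurable borel"
    using u by (simp add: gauss_L2_def cong: measurable_cong_sets)
  let ?f = "\<lambda>p t. ennreal ((u (fst p) - u (snd p))\<^sup>2) *
    (ennreal (mehler_kernel t (fst p) (snd p) / t powr (s + 1)) * indicator {0<..} t)"
  have "frac_energy s u = (\<integral>\<^sup>+x. \<integral>\<^sup>+y. (\<integral>\<^sup>+t. ?f (x, y) t \<partial>lborel) \<partial>?G \<partial>?G)"
    unfolding frac_energy_def frac_kernel_def by (simp add: nn_integral_cmult)
  also have "\<dots> = (\<integral>\<^sup>+p. (\<integral>\<^sup>+t. ?f p t \<partial>lborel) \<partial>(?G \<Otimes>\<^sub>M ?G))"
    by (rule nn_integral_fst) measurable
  also have "\<dots> = (\<integral>\<^sup>+t. (\<integral>\<^sup>+p. ?f p t \<partial>(?G \<Otimes>\<^sub>M ?G)) \<partial>lborel)"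
    by (rule PL.Fubini'[symmetric]) measurable
  also have "\<dots> = (\<integral>\<^sup>+t\<in>{0<..}. ennreal (mehler_energy u t / t powr (s + 1)) \<partial>lborel)"
  proof (rule nn_integral_cong)
    fix t :: real
    show "(\<integral>\<^sup>+p. ?f p t \<partial>(?G \<Otimes>\<^sub>M ?G)) = ennreal (mehler_energy u t / t powr (s + 1)) * indicator {0<..} t"
    proof (cases "0 < t")
      case True
      have "(\<integral>\<^sup>+p. ?f p t \<partial>(?G \<Otimes>\<^sub>M ?G)) =
        (\<integral>\<^sup>+p. ennreal ((u (fst p) - u (snd p))\<^sup>2 * mehler_kernel t (fst p) (snd p) / t powr (s + 1)) \<partial>(?G \<Otimes>\<^sub>M ?G))"
        using True by (intro nn_integral_cong) (simp add: ennreal_mult[symmetric] mehler_kernel_nonneg)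
      also have "\<dots> = ennreal (mehler_energy u t / t powr (s + 1))"
        unfolding mehler_energy_def using integrable_mehler_energy[OF u True]
        by (subst nn_integral_eq_integral) (auto simp: mehler_kernel_nonneg)
      finally show ?thesis using True by simp
    qed simp
  qed
  finally show ?thesis .
qed

lemma frac_seminorm_power2: "(frac_seminorm s u)\<^sup>2 = enn2ereal (frac_energy s u)"
  by (cases "frac_energy s u") (auto simp: frac_seminorm_def)

theorem theorem3p1:
  fixes u :: "real ^ 'n \<Rightarrow> real" and s\<^sub>0 :: real
  assumes "0 < s\<^sub>0" and "s\<^sub>0 < 1"
    and "u \<in> gauss_frac_sobolev s\<^sub>0"
  shows "((\<lambda>s. ereal s * (frac_seminorm s u)\<^sup>2) \<longlongrightarrow>
           ereal (2 * ((gauss_L2_norm u)\<^sup>2 - \<bar>LINT x|gauss_measure. u x\<bar>\<^sup>2))) (at_right 0)"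
proof -
  have u: "u \<in> gauss_L2" and fin: "frac_energy s\<^sub>0 u < \<infinity>"
    using assms(3) by (auto simp: gauss_frac_sobolev_def frac_seminorm_def less_top split: if_splits)
  note energy = frac_energy_eq_nn_integral_mehler_energy[OF u]
  have nonneg: "0 \<le> mehler_energy u t" for t
    unfolding mehler_energy_def by (simp add: mehler_kernel_nonneg)
  note abelian = abelian_power_weight[OF measurable_mehler_energy[OF u] nonneg mehler_energy_tendsto[OF u] assms(1),
      folded energy, OF fin]
  have "\<forall>\<^sub>F s in at_right 0. ereal (s * enn2real (frac_energy s u)) = ereal s * (frac_seminorm s u)\<^sup>2"
    using abelian(1)
  proof eventually_elim
    case (elim s)
    then show ?case unfolding frac_seminorm_power2 by (cases "frac_energy s u") auto
  qed
  moreover have "((\<lambda>s. ereal (s * enn2real (frac_energy s u))) \<longlongrightarrow>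
      ereal (2 * ((gauss_L2_norm u)\<^sup>2 - \<bar>LINT x|gauss_measure. u x\<bar>\<^sup>2))) (at_right 0)"
    using abelian(2) by (simp add: gauss_L2_norm_def)
  ultimately show ?thesis
    by (rule Lim_transform_eventually[rotated])
qed

end
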